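(* Let $\boldsymbol a=(a_1,a_2,\dots)\in\mathbb{Z}_2^{\mathbb{N}}$ be arbitrary and let $C(\boldsymbol a)=(c_{i,j})_{i,j\ge1}$ be the infinite matrix over $\mathbb{Z}_2$ with $c_{i,i}=1$, $c_{i,j}=a_{j-1}$ for $i<j$, and $c_{i,j}=0$ for $i>j$ (so every entry above the diagonal in column $j$ equals $a_{j-1}$). Let $m\ge 2$ and $$N_{\boldsymbol a}=1+\sum_{i=1}^{m-1}2^i(1-a_i)+2^m.$$ Let $l_0(m)=\#\{i\in\{1,\dots,m\}:a_i=0\}$, $l_1(m)=\#\{i\in\{1,\dots,m\}:a_i=1\}$, and for $\ell\in\{0,1\}$ let $$d_\ell(m)=\min\{1\le n\le m-1:\ \exists\, i\in\{1,\dots,m-n\}\text{ with } a_i=a_{i+n}=\ell \text{ and } a_{i+1}=\dots=a_{i+n-1}\ne\ell\}$$ be the minimal distance of consecutive entries equal to $\ell$ in the string $(a_1,\dots,a_m)$. Then for all $p\in[1,\infty]$: $$L_p\big(X_{N_{\boldsymbol a}}^{C(\boldsymbol a)}\big)\ge\frac13 l_0(m)+O(1)\quad\text{if } d_0(m)\ge 2,$$ and $$L_p\big(X_{N_{\boldsymbol a}}^{C(\boldsymbol a)}\big)\ge\frac13 l_1(m)+O(1)\quad\text{if } d_1(m)\ge 2,$$ where $O(1)$ denotes a quantity bounded in absolute value by a constant independent of $m$.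
   Context: $\mathbb{Z}_2=\{0,1\}$ is the field with two elements. Given an infinite non-singular upper triangular matrix $C=(c_{i,j})_{i,j\ge1}$ over $\mathbb{Z}_2$, the digital sequence $X^C=(x_n)_{n\ge0}$ is defined as follows: for $n\in\mathbb{N}_0$ with binary expansion $n=n_0+n_12+n_22^2+\cdots$, let $\vec n=(n_0,n_1,\dots)^\top$, compute $C\vec n=(y_1^{(n)},y_2^{(n)},\dots)^\top$ over $\mathbb{Z}_2$, and set $x_n=\sum_{i\ge1}y_i^{(n)}2^{-i}$. For $N\in\mathbb{N}$, $X_N^C=\{x_0,\dots,x_{N-1}\}$. For a finite point set $\mathcal P=\{x_0,\dots,x_{N-1}\}\subset[0,1)$, the discrepancy function is $\Delta_{\mathcal P}(t)=\sum_{n=0}^{N-1}\mathbf 1_{[0,t)}(x_n)-Nt$, $t\in[0,1]$, and the $L_p$ discrepancy is $L_p(\mathcal P)=\left(\int_0^1|\Delta_{\mathcal P}(t)|^p\,\mathrm dt\right)^{1/p}$ for $p<\infty$, and the supremum norm of $\Delta_{\mathcal P}$ for $p=\infty$. *)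

theory Defs
  imports "HOL-Analysis.Analysis" "HOL-Library.Z2" "HOL-Library.Extended_Nat"
begin

text \<open>
  The field with two elements is the type \<^typ>\<open>bit\<close>. Sequences and matrices over it are functions
  on \<^typ>\<open>nat\<close> whose indices start at 1; values at index 0 are never used.
\<close>

definition digit :: "nat \<Rightarrow> nat \<Rightarrow> bit" where
  "digit n k = of_bool (odd (n div 2 ^ k))"

text \<open>
  Row \<open>i\<close> of the matrix-vector product. The \<open>j\<close>-th entry of the digit vector of \<open>n\<close> is
  \<open>digit n (j - 1)\<close>, which vanishes for \<open>j > n\<close> because \<open>n < 2 ^ n\<close>; so the sum over
  \<open>1 \<le> j \<le> n\<close> is the full sum over \<open>j \<ge> 1\<close>.
\<close>

definition matvec :: "(nat \<Rightarrow> nat \<Rightarrow> bit) \<Rightarrow> nat \<Rightarrow> nat \<Rightarrow> bit" where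
  "matvec C n i = (\<Sum>j=1..n. C i j * digit n (j - 1))"

definition digital_seq :: "(nat \<Rightarrow> nat \<Rightarrow> bit) \<Rightarrow> nat \<Rightarrow> real" where
  "digital_seq C n = (\<Sum>i. of_bit (matvec C n (Suc i)) / 2 ^ Suc i)"

text \<open>
  A finite point set is given as the first \<open>N\<close> terms of a sequence, so points are counted with
  multiplicity (for a non-singular upper triangular matrix they are pairwise distinct).
\<close>

definition discrepancy_fun :: "(nat \<Rightarrow> real) \<Rightarrow> nat \<Rightarrow> real \<Rightarrow> real" where
  "discrepancy_fun x N t = (\<Sum>n<N. indicator {0..<t} (x n)) - real N * t"

definition Lp_discrepancy :: "ennreal \<Rightarrow> (nat \<Rightarrow> real) \<Rightarrow> nat \<Rightarrow> real" where
  "Lp_discrepancy p x N =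
     (if p = \<infinity> then (SUP t\<in>{0..1}. \<bar>discrepancy_fun x N t\<bar>)
      else (LBINT t:{0..1}. \<bar>discrepancy_fun x N t\<bar> powr enn2real p) powr (1 / enn2real p))"

definition C_mat :: "(nat \<Rightarrow> bit) \<Rightarrow> nat \<Rightarrow> nat \<Rightarrow> bit" where
  "C_mat a i j = (if i = j then 1 else if i < j then a (j - 1) else 0)"

definition N_of :: "(nat \<Rightarrow> bit) \<Rightarrow> nat \<Rightarrow> nat" where
  "N_of a m = 1 + (\<Sum>i=1..m-1. 2 ^ i * (1 - of_bit (a i))) + 2 ^ m"

definition count_entries :: "bit \<Rightarrow> (nat \<Rightarrow> bit) \<Rightarrow> nat \<Rightarrow> nat" where
  "count_entries l a m = card {i \<in> {1..m}. a i = l}"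

text \<open>
  The minimal distance is \<open>\<infinity>\<close>, the infimum of the empty set, if \<open>l\<close> occurs at most once among
  the first \<open>m\<close> entries.
\<close>

definition min_dist :: "bit \<Rightarrow> (nat \<Rightarrow> bit) \<Rightarrow> nat \<Rightarrow> enat" where
  "min_dist l a m =
     Inf (enat ` {n. 1 \<le> n \<and> n \<le> m - 1 \<and>
       (\<exists>i\<in>{1..m-n}. a i = l \<and> a (i + n) = l \<and> (\<forall>k\<in>{i+1..i+n-1}. a k \<noteq> l))})"

end

theory Submission
  imports Defs
begin

text \<open>
  Since \<open>[0,1]\<close> has measure one, \<open>L\<^sub>p\<close> dominates the absolute value of the mean
  \<open>\<Sum>n<N. (1/2 - x\<^sub>n)\<close> of the discrepancy function. Cut \<open>{0..<N}\<close> into dyadic blocks along the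
  binary digits \<open>N\<^sub>r = 1 - a\<^sub>r\<close> of \<open>N\<close>: over a block of length \<open>2\<^sup>r\<close> the first \<open>r\<close> digits of the
  points average out. For this matrix the remaining digits of all blocks with \<open>r < m\<close> conspire, so
  that the block contributes, with a sign depending only on \<open>a\<^sub>m\<close>, at least
  \<open>1/2 * (\<Sum>k\<ge>1. a\<^bsub>r+k\<^esub> / 2\<^sup>k)\<close>, truncated below \<open>m\<close>. The total weight \<open>\<Sum> 2\<^bsup>-(q-r)\<^esup>\<close> over pairs
  \<open>r < q\<close> with \<open>a\<^sub>r = 0\<close> and \<open>a\<^sub>q = 1\<close> is, up to a constant, at least \<open>2/3\<close> times the number of
  entries \<open>\<ell>\<close> if no two adjacent entries equal \<open>\<ell>\<close>, as \<open>1/2 + 1/8 + 1/32 + \<dots> = 2/3\<close>.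
\<close>

section \<open>Bounding the discrepancy below by its mean\<close>

text \<open>Tangent bound for the convex power; integrating it gives Jensen's inequality
  below.\<close>

lemma powr_above_tangent:
  fixes c u p :: real
  assumes "c > 0" "u \<ge> 0" "p \<ge> 1"
  shows "u powr p \<ge> c powr p + p * c powr (p - 1) * (u - c)"
proof (cases "u = 0")
  case True
  \<comment> \<open>Convexity is only used on the open half-line; at \<open>u = 0\<close> the claim
    reduces to \<open>(1 - p) * c powr p <= 0\<close>.\<close>
  have "c powr (p - 1) * c = c powr p"
    using assms powr_add[of c "p - 1" 1] by simp
  then have "c powr p + p * c powr (p - 1) * (u - c) = (1 - p) * c powr p"
    using True by (simp add: algebra_simps)
  also have "\<dots> \<le> 0"
    using assms by (simp add: mult_nonpos_nonneg)
  finally show ?thesis using True by simp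
next
  case False
  have "u powr p - c powr p \<ge> (p * c powr (p - 1)) * (u - c)"
  proof (rule convex_on_imp_above_tangent[where A = "{0<..}"])
    show "convex_on {0<..} (\<lambda>x::real. x powr p)"
      using assms by (simp add: powr_convex)
    show "((\<lambda>x. x powr p) has_real_derivative p * c powr (p - 1)) (at c within {0<..})"
      using assms by (intro has_real_derivative_powr[THEN has_field_derivative_at_within]) auto
  qed (use assms False in \<open>auto simp: interior_open\<close>)
  then show ?thesis by linarith
qed

lemma discrepancy_fun_borel [measurable]: "discrepancy_fun x N \<in> borel_measurable borel"
proof -
  have "indicator {0..<t} (x n) = (if 0 \<le> x n then indicator {x n<..} t else (0::real))" for t n
    by (auto simp: indicator_def)
  then have "discrepancy_fun x N =
      (\<lambda>t. (\<Sum>n<N. if 0 \<le> x n then indicator {x n<..} t else (0::real)) - real N * t)"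
    by (simp add: discrepancy_fun_def fun_eq_iff)
  also have "\<dots> \<in> borel_measurable borel"
    by measurable
  finally show ?thesis .
qed

lemma abs_discrepancy_fun_le:
  assumes "t \<in> {0..1}"
  shows "\<bar>discrepancy_fun x N t\<bar> \<le> real N"
proof -
  have "(\<Sum>n<N. indicator {0..<t} (x n)) \<le> (\<Sum>n<N. 1::real)"
    by (intro sum_mono) (auto simp: indicator_def)
  moreover have "(\<Sum>n<N. indicator {0..<t} (x n)) \<ge> (0::real)"
    by (intro sum_nonneg) auto
  moreover have "real N * t \<le> real N * 1" "0 \<le> real N * t"
    using assms by (intro mult_left_mono, auto)
  ultimately show ?thesis
    unfolding discrepancy_fun_def by auto
qed

lemma discrepancy_fun_set_integrable:
  fixes f :: "real \<Rightarrow> real"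
  assumes [measurable]: "f \<in> borel_measurable borel"
    and "\<And>u. \<bar>u\<bar> \<le> real N \<Longrightarrow> \<bar>f u\<bar> \<le> B"
  shows "set_integrable lborel {0..1} (\<lambda>t. f (discrepancy_fun x N t))"
  unfolding set_integrable_def
proof (rule integrableI_bounded_set[where A = "{0..1}" and B = B])
  show "AE t in lborel. t \<in> {0..1} \<longrightarrow>
      norm (indicat_real {0..1} t *\<^sub>R f (discrepancy_fun x N t)) \<le> B"
    using assms(2) abs_discrepancy_fun_le by auto
qed auto

text \<open>Each point contributes the length \<open>1 - x n\<close> of \<open>{x n<..1}\<close>,
  and \<open>N * t\<close> integrates to \<open>N/2\<close>.\<close>

lemma integral_discrepancy_fun:
  assumes "\<And>n. n < N \<Longrightarrow> x n \<in> {0..1}"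
  shows "(LBINT t:{0..1}. discrepancy_fun x N t) = (\<Sum>n<N. 1/2 - x n)"
proof -
  have eq: "indicator {0..1} t *\<^sub>R discrepancy_fun x N t =
     (\<Sum>n<N. indicator {0..1} t * indicator {x n<..} t) - real N * (indicator {0..1} t * t)" for t
    using assms
    by (auto simp: discrepancy_fun_def indicator_def sum_distrib_left algebra_simps intro!: sum.cong)
  have ind: "indicator {0..1} t * indicator {x n<..} t = (indicator {x n<..1} t :: real)" if "n < N" for n t
    using assms[OF that] by (auto simp: indicator_def)
  have id: "has_bochner_integral lborel (\<lambda>t::real. indicator {0..1} t * t) (1/2)"
  proof -
    have "has_bochner_integral lborel (\<lambda>t::real. t * indicator {0..1} t) (1\<^sup>2 / 2 - 0\<^sup>2 / 2)"
      by (rule has_bochner_integral_FTC_Icc_real) (auto intro!: derivative_eq_intros)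
    then show ?thesis by (simp add: mult.commute)
  qed
  have seg: "has_bochner_integral lborel (\<lambda>t. indicator {x n<..1} t :: real) (1 - x n)" if "n < N" for n
    using assms[OF that] has_bochner_integral_real_indicator[of "{x n<..1}" lborel] by auto
  have "has_bochner_integral lborel (\<lambda>t. indicator {0..1} t *\<^sub>R discrepancy_fun x N t)
      ((\<Sum>n<N. 1 - x n) - real N * (1/2))"
    unfolding eq
    by (intro has_bochner_integral_diff has_bochner_integral_sum has_bochner_integral_mult_right id)
      (simp add: ind seg)
  then show ?thesis
    by (simp add: set_lebesgue_integral_def has_bochner_integral_iff sum_subtractf)
qed

text \<open>Jensen on a space of measure one: for a finite exponent the tangent bound at
  \<open>c\<close> is integrated, for the infinite one the supremum dominates the mean.\<close>

lemma Lp_discrepancy_ge_mean: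
  assumes x: "\<And>n. n < N \<Longrightarrow> x n \<in> {0..1}" and p: "p \<ge> 1"
  shows "Lp_discrepancy p x N \<ge> \<bar>\<Sum>n<N. 1/2 - x n\<bar>"
proof -
  define c where "c = \<bar>\<Sum>n<N. 1/2 - x n\<bar>"
  let ?D = "discrepancy_fun x N"
  have "has_bochner_integral lborel (indicat_real {0..1::real}) 1"
    using has_bochner_integral_real_indicator[of "{0..1::real}" lborel] by simp
  then have "has_bochner_integral lborel (\<lambda>t::real. indicat_real {0..1} t *\<^sub>R k) (1 *\<^sub>R k)" for k :: real
    by (intro has_bochner_integral_scaleR_left)
  then have unit: "set_integrable lborel {0..1::real} (\<lambda>t. k)" "(LBINT t:{0..1::real}. k) = k"
    for k :: real
    unfolding set_integrable_def set_lebesgue_integral_def has_bochner_integral_iff by simp_all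
  have int: "set_integrable lborel {0..1} ?D" "set_integrable lborel {0..1} (\<lambda>t. \<bar>?D t\<bar>)"
    using discrepancy_fun_set_integrable[of "\<lambda>u. u" N "real N" x]
      discrepancy_fun_set_integrable[of abs N "real N" x] by auto
  have mean: "c \<le> (LBINT t:{0..1}. \<bar>?D t\<bar>)"
    using set_integral_norm_bound[OF int(1)] integral_discrepancy_fun[OF x] by (simp add: c_def)
  show ?thesis
  proof (cases p)
    case top
    have "(LBINT t:{0..1}. \<bar>?D t\<bar>) \<le> (LBINT t:{0..1::real}. (SUP t\<in>{0..1}. \<bar>?D t\<bar>))"
    proof (rule set_integral_mono[OF int(2) unit(1)])
      fix t :: real assume "t \<in> {0..1}"
      then show "\<bar>?D t\<bar> \<le> (SUP t\<in>{0..1}. \<bar>?D t\<bar>)"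
        using abs_discrepancy_fun_le[of _ x N]
        by (intro cSUP_upper bdd_aboveI2[where M = "real N"]) auto
    qed
    then show ?thesis
      using mean top unit(2) by (simp add: Lp_discrepancy_def c_def)
  next
    case (real q)
    have q: "q \<ge> 1"
      using p real by (metis ennreal_1 ennreal_le_iff)
    have L: "Lp_discrepancy p x N = (LBINT t:{0..1}. \<bar>?D t\<bar> powr q) powr (1 / q)"
      using real by (simp add: Lp_discrepancy_def)
    show ?thesis
    proof (cases "c = 0")
      case True
      then show ?thesis by (simp add: L c_def)
    next
      case False
      then have c: "c > 0" by (simp add: c_def)
      have lin: "set_integrable lborel {0..1} (\<lambda>t. q * c powr (q - 1) * (\<bar>?D t\<bar> - c))"
        using int(2) unit(1) by (intro set_integrable_mult_right set_integral_diff) auto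
      \<comment> \<open>By \<open>mean\<close> the linear term of the tangent has nonnegative
        integral.\<close>
      have "c powr q \<le> c powr q + q * c powr (q - 1) * ((LBINT t:{0..1}. \<bar>?D t\<bar>) - c)"
        using mean c q by auto
      also have "\<dots> = (LBINT t:{0..1}. c powr q + q * c powr (q - 1) * (\<bar>?D t\<bar> - c))"
        using lin unit int(2) by (simp add: set_integral_add set_integral_diff)
      also have "\<dots> \<le> (LBINT t:{0..1}. \<bar>?D t\<bar> powr q)"
      proof (rule set_integral_mono)
        show "set_integrable lborel {0..1} (\<lambda>t. \<bar>?D t\<bar> powr q)"
          using q by (intro discrepancy_fun_set_integrable[of "\<lambda>u. \<bar>u\<bar> powr q" N "real N powr q"])
            (auto intro!: powr_mono2)
        show "set_integrable lborel {0..1} (\<lambda>t. c powr q + q * c powr (q - 1) * (\<bar>?D t\<bar> - c))"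
          using lin unit(1) by (intro set_integral_add) auto
      qed (use powr_above_tangent c q in auto)
      finally have "(c powr q) powr (1 / q) \<le> Lp_discrepancy p x N"
        unfolding L using q by (intro powr_mono2) auto
      then show ?thesis
        using c q by (simp add: powr_powr c_def)
    qed
  qed
qed

section \<open>Digital sequences of unitriangular matrices on dyadic blocks\<close>

lemma sum_lessThan_add:
  fixes f :: "nat \<Rightarrow> 'a::comm_monoid_add"
  shows "(\<Sum>n<k + l. f n) = (\<Sum>n<k. f n) + (\<Sum>n<l. f (k + n))"
  by (induction l) (simp_all add: add.assoc)

definition unitriangular :: "(nat \<Rightarrow> nat \<Rightarrow> bit) \<Rightarrow> bool" where
  "unitriangular C \<longleftrightarrow> (\<forall>i. C (Suc i) (Suc i) = 1) \<and> (\<forall>i. \<forall>j<i. C (Suc i) (Suc j) = 0)"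

text \<open>The binary fraction formed by rows \<open>r+1, r+2, ...\<close> of the product, that is,
  \<open>2^r * x_n\<close> with its first \<open>r\<close> digits removed.\<close>

definition row_tail :: "(nat \<Rightarrow> nat \<Rightarrow> bit) \<Rightarrow> nat \<Rightarrow> nat \<Rightarrow> real" where
  "row_tail C r n = (\<Sum>i. of_bit (matvec C n (Suc (r + i))) / 2 ^ Suc i)"

lemma row_tail_terms_summable:
  fixes b :: "nat \<Rightarrow> bit"
  shows "summable (\<lambda>i. of_bit (b i) / 2 ^ Suc i :: real)"
proof (rule summable_comparison_test)
  show "summable (\<lambda>i. (1/2) ^ Suc i :: real)"
    by (intro summable_Suc_iff[THEN iffD2] summable_geometric) auto
qed (auto simp: power_one_over field_simps)

lemma row_tail_Suc:
  "row_tail C r n = (of_bit (matvec C n (Suc r)) + row_tail C (Suc r) n) / 2"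
proof -
  let ?f = "\<lambda>i. of_bit (matvec C n (Suc (r + i))) / 2 ^ Suc i :: real"
  have "row_tail C r n = (\<Sum>i. ?f (Suc i)) + ?f 0"
    unfolding row_tail_def
    using row_tail_terms_summable[of "\<lambda>i. matvec C n (Suc (r + i))"] by (subst suminf_split_head) auto
  also have "(\<Sum>i. ?f (Suc i)) = (\<Sum>i. (of_bit (matvec C n (Suc (Suc r + i))) / 2 ^ Suc i) / 2 :: real)"
    by (simp add: mult.commute)
  also have "\<dots> = row_tail C (Suc r) n / 2"
    unfolding row_tail_def
    using row_tail_terms_summable[of "\<lambda>i. matvec C n (Suc (Suc r + i))"] by (rule suminf_divide)
  finally show ?thesis by (simp add: add_divide_distrib)
qed

lemma digital_seq_eq_row_tail: "digital_seq C n = row_tail C 0 n"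
  by (simp add: digital_seq_def row_tail_def)

lemma row_tail_bounds: "row_tail C r n \<in> {0..1}"
proof -
  have s: "summable (\<lambda>i. of_bit (matvec C n (Suc (r + i))) / 2 ^ Suc i :: real)"
    by (rule row_tail_terms_summable)
  have "row_tail C r n \<le> (\<Sum>i. (1/2) ^ Suc i)"
    unfolding row_tail_def
    by (intro suminf_le s power_half_series[THEN sums_summable]) (auto simp: power_one_over field_simps)
  also have "\<dots> = 1"
    using power_half_series by (rule sums_unique[symmetric])
  finally show ?thesis
    using suminf_nonneg[OF s] by (auto simp: row_tail_def)
qed

section \<open>Binary digits, rows of the product and dyadic blocks\<close>

lemma digit_eq_0: "n < 2 ^ k \<Longrightarrow> digit n k = 0"
  by (simp add: digit_def)

text \<open>Digits vanish beyond the binary length of \<open>n\<close>, so products for different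
  \<open>n\<close> can be compared over one common range.\<close>

lemma matvec_eq:
  assumes "n < 2 ^ M"
  shows "matvec C n i = (\<Sum>k<M. C i (Suc k) * digit n k)"
proof -
  have "matvec C n i = (\<Sum>k<n. C i (Suc k) * digit n k)"
    unfolding matvec_def One_nat_def by (simp add: sum.atLeast1_atMost_eq)
  also have "\<dots> = (\<Sum>k<max n M. C i (Suc k) * digit n k)"
    by (rule sum.mono_neutral_left)
      (auto simp: digit_eq_0 less_le_trans[OF less_exp power_increasing])
  also have "\<dots> = (\<Sum>k<M. C i (Suc k) * digit n k)"
    using assms by (intro sum.mono_neutral_right)
      (auto simp: digit_eq_0 less_le_trans[OF _ power_increasing])
  finally show ?thesis .
qed

lemma digit_mult_power:
  "digit (h * 2 ^ r) k = (if r \<le> k then digit h (k - r) else 0)"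
proof (cases "r \<le> k")
  case True
  then have "h * 2 ^ r div 2 ^ k = h div 2 ^ (k - r)"
    by (metis div_mult2_eq le_add_diff_inverse mult.commute nonzero_mult_div_cancel_left
        power_add power_not_zero zero_neq_numeral)
  with True show ?thesis by (simp add: digit_def)
next
  case False
  then have "h * 2 ^ r div 2 ^ k = h * 2 ^ (r - k)"
    by (simp add: power_diff div_mult_swap le_imp_power_dvd)
  with False show ?thesis by (simp add: digit_def)
qed

text \<open>The two arguments differ only in digit \<open>r\<close>, which adds column
  \<open>Suc r\<close>; from the diagonal downwards that column is a one followed by zeros.\<close>

lemma matvec_odd_block:
  assumes "unitriangular C" "r \<le> i"
  shows "matvec C ((2 * h + 1) * 2 ^ r) (Suc i) =
    matvec C (h * 2 ^ Suc r) (Suc i) + (if i = r then 1 else 0)"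
proof -
  define M where "M = (2 * h + 1) * 2 ^ r + Suc r"
  have M: "(2 * h + 1) * 2 ^ r < 2 ^ M" "h * 2 ^ Suc r < 2 ^ M" "r < M"
    using less_exp[of M] by (auto simp: M_def algebra_simps)
  have dig: "digit ((2 * h + 1) * 2 ^ r) k = digit (h * 2 ^ Suc r) k + (if k = r then 1 else 0)" for k
  proof -
    consider "k < r" | "k = r" | l where "k = Suc (r + l)"
      by (metis less_imp_Suc_add linorder_neqE_nat)
    then show ?thesis
      unfolding digit_mult_power by cases (auto simp: digit_def div_mult2_eq)
  qed
  have "matvec C ((2 * h + 1) * 2 ^ r) (Suc i) =
      (\<Sum>k<M. C (Suc i) (Suc k) * digit (h * 2 ^ Suc r) k + (if k = r then C (Suc i) (Suc k) else 0))"
    unfolding matvec_eq[OF M(1)] dig by (intro sum.cong) (auto simp: distrib_left)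
  also have "\<dots> = matvec C (h * 2 ^ Suc r) (Suc i) + C (Suc i) (Suc r)"
    unfolding matvec_eq[OF M(2)] sum.distrib using M(3) by simp
  also have "C (Suc i) (Suc r) = (if i = r then 1 else 0)"
    using assms by (auto simp: unitriangular_def)
  finally show ?thesis .
qed

text \<open>The first \<open>r\<close> digits of the points take every pattern once and the later
  rows are constant on the block, so the points sum to \<open>(2^r - 1)/2\<close> plus the tail. The
  induction halves the block.\<close>

lemma block_sum:
  assumes C: "unitriangular C"
  shows "(\<Sum>n<2 ^ r. 1/2 - digital_seq C (h * 2 ^ r + n)) = 1/2 - row_tail C r (h * 2 ^ r)"
proof (induction r arbitrary: h)
  case 0
  then show ?case by (simp add: digital_seq_eq_row_tail)
next
  case (Suc r)
  let ?x = "\<lambda>n. 1/2 - digital_seq C n"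
  have "row_tail C (Suc r) ((2 * h + 1) * 2 ^ r) = row_tail C (Suc r) (h * 2 ^ Suc r)"
    unfolding row_tail_def using matvec_odd_block[OF C, of r _ h] by simp
  moreover have "of_bit (matvec C ((2 * h + 1) * 2 ^ r) (Suc r)) +
      of_bit (matvec C (h * 2 ^ Suc r) (Suc r)) = (1::real)"
    unfolding matvec_odd_block[OF C order_refl] by (cases "matvec C (h * 2 ^ Suc r) (Suc r)") auto
  \<comment> \<open>The halves share the tail after row \<open>Suc r\<close> and have complementary
    digits in that row.\<close>
  ultimately have tails: "row_tail C r (h * 2 ^ Suc r) + row_tail C r ((2 * h + 1) * 2 ^ r) =
      1/2 + row_tail C (Suc r) (h * 2 ^ Suc r)"
    unfolding row_tail_Suc[of C r] by argo
  have "(\<Sum>n<2 ^ Suc r. ?x (h * 2 ^ Suc r + n)) =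
      (\<Sum>n<2 ^ r. ?x (h * 2 ^ Suc r + n)) + (\<Sum>n<2 ^ r. ?x (h * 2 ^ Suc r + (2 ^ r + n)))"
    by (simp add: mult_2 sum_lessThan_add)
  also have "\<dots> = (\<Sum>n<2 ^ r. ?x ((2 * h) * 2 ^ r + n)) + (\<Sum>n<2 ^ r. ?x ((2 * h + 1) * 2 ^ r + n))"
    by (simp add: algebra_simps)
  also have "\<dots> = 1 - (row_tail C r (h * 2 ^ Suc r) + row_tail C r ((2 * h + 1) * 2 ^ r))"
    unfolding Suc.IH by (simp add: mult.assoc mult.commute[of h])
  finally show ?case
    unfolding tails by simp
qed


text \<open>Each binary digit one of \<open>N\<close> at position \<open>r < q\<close> splits off a
  block of length \<open>2^r\<close>, starting at \<open>N\<close> with digits \<open>0..r\<close>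
  cleared.\<close>

lemma sum_dyadic_blocks:
  fixes f :: "nat \<Rightarrow> 'a::comm_monoid_add"
  shows "(\<Sum>n<N. f n) =
    (\<Sum>r<q. if odd (N div 2 ^ r) then \<Sum>n<2 ^ r. f (N div 2 ^ Suc r * 2 ^ Suc r + n) else 0) +
    (\<Sum>n<N div 2 ^ q * 2 ^ q. f n)"
proof (induction q)
  case (Suc q)
  have eq: "N div 2 ^ q = 2 * (N div 2 ^ Suc q) + of_bool (odd (N div 2 ^ q))"
    by (simp add: div_mult2_eq power_Suc2 del: power_Suc)
  have "N div 2 ^ q * 2 ^ q = N div 2 ^ Suc q * 2 ^ Suc q + of_bool (odd (N div 2 ^ q)) * 2 ^ q"
    by (subst eq) (simp add: algebra_simps)
  then have "(\<Sum>n<N div 2 ^ q * 2 ^ q. f n) = (\<Sum>n<N div 2 ^ Suc q * 2 ^ Suc q. f n) +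
      (if odd (N div 2 ^ q) then \<Sum>n<2 ^ q. f (N div 2 ^ Suc q * 2 ^ Suc q + n) else 0)"
    by (simp add: sum_lessThan_add del: power_Suc)
  then show ?case
    unfolding Suc.IH by (simp add: ac_simps del: power_Suc)
qed simp

section \<open>The matrix \<open>C(a)\<close> and the number \<open>N\<^sub>a\<close>\<close>

lemma unitriangular_C_mat: "unitriangular (C_mat a)"
  by (simp add: unitriangular_def C_mat_def)

text \<open>With digits counted from zero, the column met by digit \<open>k\<close> carries
  \<open>a k\<close>, the same index that enters digit \<open>k\<close> of
  \<open>N_of\<close>.\<close>

lemma matvec_C_mat:
  assumes "n < 2 ^ M"
  shows "matvec (C_mat a) n (Suc i) = digit n i + (\<Sum>k\<in>{Suc i..<M}. a k * digit n k)"
proof -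
  have "matvec (C_mat a) n (Suc i) =
      (\<Sum>k<M. (if k = i then digit n k else 0) + (if i < k then a k * digit n k else 0))"
    unfolding matvec_eq[OF assms] by (intro sum.cong) (auto simp: C_mat_def)
  also have "\<dots> = (if i < M then digit n i else 0) + (\<Sum>k<M. if i < k then a k * digit n k else 0)"
    unfolding sum.distrib by (simp add: sum.delta)
  also have "(if i < M then digit n i else 0) = digit n i"
    using assms by (auto simp: digit_eq_0 less_le_trans[OF _ power_increasing])
  also have "(\<Sum>k<M. if i < k then a k * digit n k else 0) = (\<Sum>k\<in>{Suc i..<M}. a k * digit n k)"
    unfolding sum.inter_filter[symmetric, OF finite_lessThan] by (intro sum.cong) auto
  finally show ?thesis .
qed

lemma N_of_eq_sum:
  assumes "m \<ge> 1"
  shows "N_of a m = (\<Sum>k<Suc m. of_bool (k = 0 \<or> k = m \<or> a k = 0) * 2 ^ k)"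
proof -
  have "{..<Suc m} = insert 0 (insert m {1..m-1})"
    using assms by auto
  moreover have "(\<Sum>i=1..m-1. 2 ^ i * (1 - of_bit (a i))) =
      (\<Sum>k=1..m-1. of_bool (k = 0 \<or> k = m \<or> a k = 0) * 2 ^ k :: nat)"
  proof (intro sum.cong refl)
    fix i assume "i \<in> {1..m-1}"
    then show "2 ^ i * (1 - of_bit (a i)) = (of_bool (i = 0 \<or> i = m \<or> a i = 0) * 2 ^ i :: nat)"
      by (cases "a i") auto
  qed
  ultimately show ?thesis
    using assms by (simp add: N_of_def)
qed

lemma digit_N_of:
  assumes "m \<ge> 1"
  shows "digit (N_of a m) k = of_bool (k \<le> m \<and> (k = 0 \<or> k = m \<or> a k = 0))"
proof -
  let ?b = "\<lambda>k. k = 0 \<or> k = m \<or> a k = 0"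
  have "N_of a m = horner_sum of_bool 2 (map ?b [0..<Suc m])"
    unfolding N_of_eq_sum[OF assms] horner_sum_eq_sum
    by (intro sum.cong) (auto simp del: upt_Suc)
  then have "bit (N_of a m) k \<longleftrightarrow> k \<le> m \<and> ?b k"
    by (auto simp add: bit_horner_sum_bit_iff simp del: upt_Suc)
  then show ?thesis
    by (simp add: digit_def bit_iff_odd)
qed

lemma N_of_less:
  assumes "m \<ge> 1"
  shows "N_of a m < 2 ^ Suc m"
proof -
  have "N_of a m \<le> (\<Sum>k<Suc m. 2 ^ k)"
    unfolding N_of_eq_sum[OF assms] by (intro sum_mono) auto
  also have "\<dots> < 2 ^ Suc m"
    by (simp add: lessThan_atLeast0 sum_power2 del: power_Suc sum.op_ivl_Suc)
  finally show ?thesis .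
qed

text \<open>
  In every row above the \<open>m\<close>-th the products \<open>a\<^sub>k N\<^sub>k\<close> with \<open>k < m\<close> vanish because
  \<open>N\<^sub>k = 1 - a\<^sub>k\<close>, so all these rows pick up the same summand \<open>a\<^sub>m\<close>.
\<close>

lemma matvec_N_of:
  assumes "m \<ge> 1" "r \<le> i"
  shows "matvec (C_mat a) (N_of a m div 2 ^ Suc r * 2 ^ Suc r) (Suc i) =
    (if r < i then digit (N_of a m) i else 0) + (if i < m then a m else 0)"
proof -
  let ?n = "N_of a m div 2 ^ Suc r * 2 ^ Suc r"
  have dig: "digit ?n k = (if r < k then digit (N_of a m) k else 0)" for k
  proof (cases "r < k")
    case True
    then obtain l where "k = Suc r + l"
      by (metis less_eq_Suc_le le_Suc_ex)
    then show ?thesis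
      by (simp add: digit_mult_power digit_def power_add div_mult2_eq)
  qed (simp add: digit_mult_power del: power_Suc)
  have "?n < 2 ^ Suc m"
    using N_of_less[OF assms(1)] by (rule le_less_trans[rotated]) (rule div_times_less_eq_dividend)
  then have "matvec (C_mat a) ?n (Suc i) = digit ?n i + (\<Sum>k\<in>{Suc i..<Suc m}. a k * digit ?n k)"
    by (rule matvec_C_mat)
  also have "(\<Sum>k\<in>{Suc i..<Suc m}. a k * digit ?n k) = (\<Sum>k\<in>{Suc i..<Suc m}. if k = m then a k else 0)"
  proof (intro sum.cong refl)
    fix k assume "k \<in> {Suc i..<Suc m}"
    then show "a k * digit ?n k = (if k = m then a k else 0)"
      using assms unfolding dig digit_N_of[OF assms(1)] by (cases "a k") auto
  qed
  finally show ?thesis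
    by (auto simp: dig simp del: power_Suc)
qed

text \<open>Counted from zero, row \<open>j\<close> with \<open>r < j < m\<close> has entry
  \<open>1 - a j + a m\<close>. Complementing the tail when \<open>a m = 0\<close> makes this
  \<open>a j\<close> in both cases, while row \<open>r\<close> has entry \<open>a m\<close>, which
  yields the sign.\<close>

lemma block_sum_lower_bound:
  assumes "r < m" and "a r = 0 \<or> r = 0"
  shows "(if a m = 0 then 1 else -1) *
      (1/2 - row_tail (C_mat a) r (N_of a m div 2 ^ Suc r * 2 ^ Suc r))
    \<ge> (\<Sum>q\<in>{Suc r..<m}. of_bit (a q) / 2 ^ (q - r)) / 2"
proof -
  define n where "n = N_of a m div 2 ^ Suc r * 2 ^ Suc r"
  define D where "D = (\<lambda>j. if a m = 0 then 1 - row_tail (C_mat a) j n else row_tail (C_mat a) j n)"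
  have m: "m \<ge> 1" using assms by simp
  note y = matvec_N_of[OF m, of r _ a, folded n_def]
  \<comment> \<open>Downward from \<open>m\<close>, where only \<open>D m >= 0\<close> is used, each
    step prepends the digit \<open>a j\<close>.\<close>
  have D: "D j \<ge> (\<Sum>q\<in>{j..<m}. of_bit (a q) / 2 ^ (Suc q - j))" if "j \<le> m" "r < j" for j
    using that
  proof (induction j rule: inc_induct)
    case base
    show ?case using row_tail_bounds[of "C_mat a" m n] by (auto simp: D_def)
  next
    case (step j)
    have "(\<Sum>q\<in>{j..<m}. of_bit (a q) / 2 ^ (Suc q - j) :: real) =
        of_bit (a j) / 2 + (\<Sum>q\<in>{Suc j..<m}. of_bit (a q) / 2 ^ (Suc q - j))"
      using step.hyps by (simp add: sum.atLeast_Suc_lessThan)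
    also have "(\<Sum>q\<in>{Suc j..<m}. of_bit (a q) / 2 ^ (Suc q - j) :: real) =
        (\<Sum>q\<in>{Suc j..<m}. of_bit (a q) / 2 ^ (Suc q - Suc j)) / 2"
      unfolding sum_divide_distrib by (intro sum.cong) (auto simp: Suc_diff_le)
    also have "of_bit (a j) / 2 + \<dots> \<le> (of_bit (a j) + D (Suc j)) / 2"
      using step by simp
    also have "\<dots> = D j"
      using step.hyps step.prems unfolding D_def row_tail_Suc[of _ j] y[OF less_imp_le[OF step.prems]]
      by (cases "a j"; cases "a m") (auto simp: digit_N_of[OF m] field_simps)
    finally show ?case .
  qed
  have "(if a m = 0 then 1 else -1) * (1/2 - row_tail (C_mat a) r n) = D (Suc r) / 2"
    unfolding D_def row_tail_Suc[of _ r] y[OF order_refl] using assms(1)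
    by (cases "a m") (auto simp: field_simps)
  then show ?thesis
    using D[of "Suc r"] assms(1) unfolding n_def by simp
qed


section \<open>The weighted count of pairs\<close>

text \<open>Here \<open>z\<close> marks the zeros of \<open>a\<close>. Grouping the pairs by their
  right end \<open>q\<close> gives a one-step recursion in \<open>q\<close>.\<close>

definition lag_weight :: "(nat \<Rightarrow> bool) \<Rightarrow> nat \<Rightarrow> real" where
  "lag_weight z q = (\<Sum>r\<in>{1..<q}. of_bool (z r) / 2 ^ (q - r))"

definition pair_weight :: "(nat \<Rightarrow> bool) \<Rightarrow> nat \<Rightarrow> real" where
  "pair_weight z M = (\<Sum>q=1..M. of_bool (\<not> z q) * lag_weight z q)"

lemma lag_weight_Suc:
  assumes "q \<ge> 1"
  shows "lag_weight z (Suc q) = (of_bool (z q) + lag_weight z q) / 2"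
proof -
  have "lag_weight z (Suc q) = (\<Sum>r\<in>{1..<q}. of_bool (z r) / 2 ^ (Suc q - r)) + of_bool (z q) / 2"
    using assms by (simp add: lag_weight_def)
  also have "(\<Sum>r\<in>{1..<q}. of_bool (z r) / 2 ^ (Suc q - r) :: real) = lag_weight z q / 2"
    unfolding lag_weight_def sum_divide_distrib by (intro sum.cong) (auto simp: Suc_diff_le)
  finally show ?thesis by simp
qed

lemma lag_weight_1 [simp]: "lag_weight z (Suc 0) = 0"
  by (simp add: lag_weight_def)

lemma lag_weight_bounds:
  assumes "q \<ge> 1"
  shows "0 \<le> lag_weight z q \<and> lag_weight z q \<le> 1"
  using assms by (induction q rule: dec_induct) (auto simp: lag_weight_Suc)

lemma pair_weight_Suc:
  "pair_weight z (Suc M) = pair_weight z M + of_bool (\<not> z (Suc M)) * lag_weight z (Suc M)"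
  by (simp add: pair_weight_def)

lemma card_filter_Suc:
  "real (card {i \<in> {1..Suc M}. P i}) = real (card {i \<in> {1..M}. P i}) + of_bool (P (Suc M))"
proof -
  have "{i \<in> {1..Suc M}. P i} =
      (if P (Suc M) then insert (Suc M) {i \<in> {1..M}. P i} else {i \<in> {1..M}. P i})"
    by (auto simp: le_Suc_eq)
  then show ?thesis by simp
qed

text \<open>
  In both cases the potential added to the pair weight is exactly preserved along alternating
  strings, which are the extremal ones.
\<close>

lemma pair_weight_ge_isolated:
  assumes "M \<ge> 1" "\<forall>i\<in>{1..<M}. \<not> (z i \<and> z (Suc i))"
  shows "pair_weight z M + (if z M then 4/3 else 2/3) * lag_weight z (Suc M)
    \<ge> 2/3 * real (card {i \<in> {1..M}. z i})"
  using assms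
proof (induction M rule: dec_induct)
  case base
  have eq: "{i \<in> {1..1}. z i} = (if z 1 then {1} else {})" by auto
  show ?case
    unfolding eq using lag_weight_Suc[of 1 z] by (cases "z 1") (simp_all add: pair_weight_def)
next
  case (step M)
  have "\<not> (z M \<and> z (Suc M))" using step by auto
  moreover have "2/3 * real (card {i \<in> {1..M}. z i}) \<le>
      pair_weight z M + (if z M then 4/3 else 2/3) * lag_weight z (Suc M)"
    using step by auto
  \<comment> \<open>The coefficients \<open>x\<close> after a marked and \<open>y\<close> after an
    unmarked entry solve \<open>x = 1 + y/2\<close> and \<open>y = x/2\<close>; a new marked entry
    gains \<open>x/2 = 2/3\<close>. Two unmarked entries in a row lose nothing, as the lag weight is
    nonnegative.\<close>
  ultimately show ?case
    unfolding pair_weight_Suc card_filter_Suc lag_weight_Suc[OF le_SucI[OF step.hyps(1)]]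
    using lag_weight_bounds[of "Suc M" z] by (cases "z M"; cases "z (Suc M)") (auto simp: field_simps)
qed

lemma pair_weight_ge_isolated_compl:
  assumes "M \<ge> 1" "\<forall>i\<in>{1..<M}. z i \<or> z (Suc i)"
  shows "pair_weight z M + (if z M then 4/3 * lag_weight z (Suc M) else 2/3 + 2/3 * lag_weight z (Suc M))
    \<ge> 2/3 * real (card {i \<in> {1..M}. \<not> z i})"
  using assms
proof (induction M rule: dec_induct)
  case base
  have eq: "{i \<in> {1..1}. \<not> z i} = (if z 1 then {} else {1})" by auto
  show ?case
    unfolding eq using lag_weight_Suc[of 1 z] by (cases "z 1") (simp_all add: pair_weight_def)
next
  case (step M)
  have "z M \<or> z (Suc M)" using step by auto
  moreover have "2/3 * real (card {i \<in> {1..M}. \<not> z i}) \<le> pair_weight z M +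
      (if z M then 4/3 * lag_weight z (Suc M) else 2/3 + 2/3 * lag_weight z (Suc M))"
    using step by auto
  \<comment> \<open>The same coefficients, with \<open>2/3\<close> credited in advance to an
    unmarked last entry. Two marked entries in a row lose nothing, as the lag weight is at most
    \<open>1\<close>.\<close>
  ultimately show ?case
    unfolding pair_weight_Suc card_filter_Suc lag_weight_Suc[OF le_SucI[OF step.hyps(1)]]
    using lag_weight_bounds[of "Suc M" z] by (cases "z M"; cases "z (Suc M)") (auto simp: field_simps)
qed

text \<open>Since the lag weight is at most \<open>1\<close>, either potential is at most
  \<open>4/3\<close>.\<close>

lemma pair_weight_ge_count:
  assumes "M \<ge> 1" "\<forall>i\<in>{1..<M}. \<not> (a i = l \<and> a (Suc i) = l)"
  shows "pair_weight (\<lambda>i. a i = (0::bit)) M \<ge> 2/3 * real (card {i \<in> {1..M}. a i = l}) - 4/3"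
proof (cases l)
  case zero
  then have "\<forall>i\<in>{1..<M}. \<not> (a i = 0 \<and> a (Suc i) = 0)"
    using assms(2) by simp
  from pair_weight_ge_isolated[OF assms(1) this] show ?thesis
    using lag_weight_bounds[of "Suc M" "\<lambda>i. a i = 0"] zero by (auto split: if_splits)
next
  case one
  then have "\<forall>i\<in>{1..<M}. a i = 0 \<or> a (Suc i) = 0"
    using assms(2) by auto
  from pair_weight_ge_isolated_compl[OF assms(1) this] show ?thesis
    using lag_weight_bounds[of "Suc M" "\<lambda>i. a i = 0"] one by (auto split: if_splits)
qed

text \<open>Regroups the pairs by their left end \<open>r\<close>, which indexes the dyadic
  blocks.\<close>

lemma pair_weight_swap:
  "pair_weight (\<lambda>i. a i = (0::bit)) M =
    (\<Sum>r=1..M. of_bool (a r = 0) * (\<Sum>q\<in>{Suc r..<Suc M}. of_bit (a q) / 2 ^ (q - r)))"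
proof -
  let ?f = "\<lambda>r q. of_bool (a r = 0 \<and> a q = 1) / 2 ^ (q - r) :: real"
  have "pair_weight (\<lambda>i. a i = 0) M = (\<Sum>q=1..M. \<Sum>r\<in>{1..<q}. ?f r q)"
    unfolding pair_weight_def lag_weight_def sum_distrib_left by (intro sum.cong) auto
  also have "\<dots> = (\<Sum>r=1..M. \<Sum>q\<in>{Suc r..<Suc M}. ?f r q)"
    by (subst (1 2) sum.Sigma)
      (simp_all del: sum.op_ivl_Suc,
        rule sum.reindex_bij_witness[where i = prod.swap and j = prod.swap], auto)
  also have "\<dots> = (\<Sum>r=1..M. of_bool (a r = 0) * (\<Sum>q\<in>{Suc r..<Suc M}. of_bit (a q) / 2 ^ (q - r)))"
    unfolding sum_distrib_left by (intro sum.cong refl) (auto simp: of_bool_def)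
  finally show ?thesis .
qed

section \<open>The lower bound\<close>

lemma mean_discrepancy_lower_bound:
  assumes "M \<ge> 1"
  shows "\<bar>\<Sum>n<N_of a (Suc M). 1/2 - digital_seq (C_mat a) n\<bar>
    \<ge> pair_weight (\<lambda>i. a i = 0) M / 2 - 1/2"
proof -
  let ?N = "N_of a (Suc M)"
  define s :: real where "s = (if a (Suc M) = 0 then 1 else -1)"
  define b where "b = (\<lambda>r. 1/2 - row_tail (C_mat a) r (?N div 2 ^ Suc r * 2 ^ Suc r))"
  define w where "w = (\<lambda>r. \<Sum>q\<in>{Suc r..<Suc M}. of_bit (a q) / 2 ^ (q - r) :: real)"
  have block: "(\<Sum>n<2 ^ r. 1/2 - digital_seq (C_mat a) (?N div 2 ^ Suc r * 2 ^ Suc r + n)) = b r" for r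
    using block_sum[OF unitriangular_C_mat, of a "?N div 2 ^ Suc r * 2" r]
    by (simp add: b_def mult.assoc)
  have odd: "odd (?N div 2 ^ r) \<longleftrightarrow> r \<le> Suc M \<and> (r = 0 \<or> r = Suc M \<or> a r = 0)" for r
  proof -
    have "odd (?N div 2 ^ r) \<longleftrightarrow> digit ?N r = 1"
      by (simp add: digit_def)
    then show ?thesis
      using digit_N_of[of "Suc M" a r] by simp
  qed
  have zero: "?N div 2 ^ Suc (Suc M) = 0"
    using N_of_less[of "Suc M" a] by simp
  have "(\<Sum>n<?N. 1/2 - digital_seq (C_mat a) n) =
      (\<Sum>r<Suc (Suc M). if odd (?N div 2 ^ r) then b r else 0)"
    unfolding sum_dyadic_blocks[where N = ?N and q = "Suc (Suc M)"] block zero by simp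
  also have "\<dots> = b 0 + (\<Sum>r=1..M. of_bool (a r = 0) * b r) + b (Suc M)"
  proof -
    have "{..<Suc (Suc M)} = insert 0 (insert (Suc M) {1..M})" by auto
    moreover have "(\<Sum>r=1..M. if odd (?N div 2 ^ r) then b r else 0) = (\<Sum>r=1..M. of_bool (a r = 0) * b r)"
      by (intro sum.cong) (auto simp: odd)
    ultimately show ?thesis using odd[of 0] odd[of "Suc M"] by simp
  qed
  finally have total: "s * (\<Sum>n<?N. 1/2 - digital_seq (C_mat a) n) =
      s * b 0 + (\<Sum>r=1..M. of_bool (a r = 0) * (s * b r)) + s * b (Suc M)"
    by (simp only: distrib_left sum_distrib_left mult.left_commute)
  have sb: "s * b r \<ge> w r / 2" if "r \<le> M" "a r = 0 \<or> r = 0" for r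
    using block_sum_lower_bound[of r "Suc M" a] that by (simp add: s_def b_def w_def del: power_Suc)
  have "w 0 \<ge> 0"
    unfolding w_def by (intro sum_nonneg) auto
  then have "s * b 0 \<ge> 0"
    using sb[of 0] by simp
  \<comment> \<open>The leading block lies outside the block estimate; its tail is in
    \<open>{0..1}\<close>, so it costs at most \<open>1/2\<close>.\<close>
  moreover have "s * b (Suc M) \<ge> - 1/2"
    using row_tail_bounds[of "C_mat a" "Suc M" "?N div 2 ^ Suc (Suc M) * 2 ^ Suc (Suc M)"]
    by (auto simp: s_def b_def simp del: power_Suc)
  moreover have "pair_weight (\<lambda>i. a i = 0) M / 2 \<le> (\<Sum>r=1..M. of_bool (a r = 0) * (s * b r))"
  proof -
    have "pair_weight (\<lambda>i. a i = 0) M = (\<Sum>r=1..M. of_bool (a r = 0) * w r)"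
      unfolding pair_weight_swap w_def ..
    then show ?thesis
      unfolding sum_divide_distrib using sb by (auto simp: sum_divide_distrib intro!: sum_mono)
  qed
  ultimately have "pair_weight (\<lambda>i. a i = 0) M / 2 - 1/2 \<le> s * (\<Sum>n<?N. 1/2 - digital_seq (C_mat a) n)"
    unfolding total by linarith
  then show ?thesis
    by (auto simp: s_def split: if_splits)
qed

section \<open>From the minimal distance to the final bound\<close>

lemma no_adjacent_if_min_dist:
  assumes "m \<ge> 2" "min_dist l a m \<ge> 2" "1 \<le> i" "i < m"
  shows "\<not> (a i = l \<and> a (Suc i) = l)"
proof
  assume "a i = l \<and> a (Suc i) = l"
  \<comment> \<open>Adjacent entries realise distance \<open>n = 1\<close>, where the range of
    intermediate \<open>k\<close> is empty.\<close>
  then have "min_dist l a m \<le> enat 1"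
    unfolding min_dist_def using assms by (intro Inf_lower imageI CollectI conjI bexI[where x = i]) auto
  then have "(2::enat) \<le> enat 1" using assms(2) by (rule order_trans[rotated])
  then show False by (simp add: numeral_eq_enat)
qed

lemma Lp_discrepancy_lower_bound:
  assumes m: "m \<ge> 2" and p: "p \<ge> 1" and d: "min_dist l a m \<ge> 2"
  shows "Lp_discrepancy p (digital_seq (C_mat a)) (N_of a m) \<ge> 1/3 * real (count_entries l a m) - 3/2"
proof -
  obtain M where M: "m = Suc M" "M \<ge> 1"
    using m by (cases m) auto
  \<comment> \<open>Pairs only reach \<open>M = m - 1\<close>, so entry \<open>m\<close> may be lost
    from the count. After halving, the losses are \<open>1/3 + 2/3 + 1/2 = 3/2\<close>.\<close>
  have "2/3 * real (card {i \<in> {1..M}. a i = l}) - 4/3 \<le> pair_weight (\<lambda>i. a i = 0) M"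
    using no_adjacent_if_min_dist[OF m d] M by (intro pair_weight_ge_count) auto
  moreover have "real (count_entries l a m) \<le> real (card {i \<in> {1..M}. a i = l}) + 1"
    unfolding count_entries_def M(1) card_filter_Suc by simp
  moreover have "pair_weight (\<lambda>i. a i = 0) M / 2 - 1/2
      \<le> \<bar>\<Sum>n<N_of a m. 1/2 - digital_seq (C_mat a) n\<bar>"
    unfolding M(1) by (rule mean_discrepancy_lower_bound[OF M(2)])
  moreover have "\<bar>\<Sum>n<N_of a m. 1/2 - digital_seq (C_mat a) n\<bar>
      \<le> Lp_discrepancy p (digital_seq (C_mat a)) (N_of a m)"
    using p row_tail_bounds by (intro Lp_discrepancy_ge_mean) (auto simp: digital_seq_eq_row_tail)
  ultimately show ?thesis by linarith
qed

theorem theorem2: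
  shows "\<exists>K::real. \<forall>(a :: nat \<Rightarrow> bit) (m :: nat) (p :: ennreal). m \<ge> 2 \<longrightarrow> p \<ge> 1 \<longrightarrow>
    (min_dist 0 a m \<ge> 2 \<longrightarrow>
      Lp_discrepancy p (digital_seq (C_mat a)) (N_of a m) \<ge> 1/3 * real (count_entries 0 a m) - K) \<and>
    (min_dist 1 a m \<ge> 2 \<longrightarrow>
      Lp_discrepancy p (digital_seq (C_mat a)) (N_of a m) \<ge> 1/3 * real (count_entries 1 a m) - K)"
  \<comment> \<open>\<open>K = 3/2\<close> serves both values of \<open>l\<close>, uniformly in
    \<open>a\<close>, \<open>m\<close> and \<open>p\<close>.\<close>
  using Lp_discrepancy_lower_bound by blast

end
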